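(* Let $N$ be a positive integer and let $p_1,p_2$ be real numbers with $p_1\neq1$, such that none of the hypergeometric denominators below vanishes. Let $b_n,c_n,d_n$ be the multiple Kravchuk recurrence coefficients given in the context, and let $T_m$ be the corresponding tetradiagonal matrices. Put $z=\frac{p_2-p_1}{1-p_1}$ and for $n\ge0$ set $$a_{6n+1}=(N-2n)p_1,\qquad a_{6n+4}=(N-2n-1)p_2,$$ $$a_{6n+2}=\frac{(n)_n(N-2n)(p_2-p_1)}{(n+1)_n}\cdot\frac{{}_2F_1\left[{-n,\,-N\atop -2n+1};z\right]}{{}_2F_1\left[{-n,\,-N\atop -2n};z\right]},\qquad a_{6n+5}=\frac{(n+1)(N-2n-1)(p_1-p_2)}{2n+1}\cdot\frac{{}_2F_1\left[{-n,\,-N\atop -2n};z\right]}{{}_2F_1\left[{-n-1,\,-N\atop -2n-1};z\right]},$$ $$a_{6n+3}=(2n+1)(1-p_1)\frac{{}_2F_1\left[{-n-1,\,-N\atop -2n-1};z\right]}{{}_2F_1\left[{-n,\,-N\atop -2n};z\right]},\qquad a_{6n+6}=2(n+1)(1-p_2)\frac{{}_2F_1\left[{-n-1,\,-N\atop -2n-2};z\right]}{{}_2F_1\left[{-n-1,\,-N\atop -2n-1};z\right]}.$$ Then for every $m\in\{1,\dots,N+1\}$ one has the bidiagonal factorization $T_m=L_{1,m}L_{2,m}U_m$, with $L_{1,m},L_{2,m},U_m$ built from these $a_n$ as in the context.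
   Context: Matrices. Given sequences $(b_n)_{n\ge0},(c_n)_{n\ge1},(d_n)_{n\ge2}$, $T_m$ is the $m\times m$ matrix (rows and columns numbered from $1$) with $(T_m)_{i,i}=b_{i-1}$, $(T_m)_{i,i+1}=1$, $(T_m)_{i+1,i}=c_i$, $(T_m)_{i+2,i}=d_{i+1}$ and all other entries $0$. Given $(a_n)_{n\ge1}$: $L_{1,m}$ is the $m\times m$ lower bidiagonal matrix with $1$'s on the diagonal and $(L_{1,m})_{i+1,i}=a_{3i-1}$; $L_{2,m}$ is lower bidiagonal with $1$'s on the diagonal and $(L_{2,m})_{i+1,i}=a_{3i}$; $U_m$ is upper bidiagonal with diagonal entries $(U_m)_{i,i}=a_{3i-2}$ and $1$'s on the superdiagonal. Notation. $(x)_k=x(x+1)\cdots(x+k-1)$, $(x)_0=1$ (in particular $(0)_0=1$). For a nonnegative integer $p$, ${}_2F_1\left[{-p,\,x\atop u};z\right]=\sum_{j=0}^{p}\frac{(-p)_j(x)_j}{(u)_j\,j!}z^j$ (terms $j>p$ are discarded even if $u$ is a nonpositive integer). Recurrence coefficients (multiple Kravchuk), $k\ge0$: $b_{2k}=2k+(N-3k)p_1-kp_2$; $b_{2k+1}=2k+1-(k+1)p_1+(N-3k-1)p_2$; $c_{2k}=(N-2k+1)k\big(p_1(1-p_1)+p_2(1-p_2)\big)$; $c_{2k+1}=(N-2k)\big((k+1)p_1(1-p_1)+kp_2(1-p_2)\big)$; $d_{2k}=(N-2k+1)(N-2k+2)k\,p_1(1-p_1)(p_1-p_2)$; $d_{2k+1}=(N-2k)(N-2k+1)k\,p_2(1-p_2)(p_2-p_1)$.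 *)

theory Defs
  imports Complex_Main "Jordan_Normal_Form.Matrix"
begin

(* Matrices of type 'a mat are indexed from 0; the entry functions passed to mat1 are
   written with rows and columns numbered from 1. *)
definition mat1 :: "nat \<Rightarrow> (nat \<Rightarrow> nat \<Rightarrow> real) \<Rightarrow> real mat" where
  "mat1 m f = mat m m (\<lambda>(i, j). f (i + 1) (j + 1))"

definition tetradiag ::
  "(nat \<Rightarrow> real) \<Rightarrow> (nat \<Rightarrow> real) \<Rightarrow> (nat \<Rightarrow> real) \<Rightarrow> nat \<Rightarrow> real mat" where
  "tetradiag b c d m = mat1 m (\<lambda>i j.
     if i = j then b (i - 1)
     else if j = i + 1 then 1
     else if i = j + 1 then c j
     else if i = j + 2 then d (j + 1)
     else 0)"

definition L1_mat :: "(nat \<Rightarrow> real) \<Rightarrow> nat \<Rightarrow> real mat" where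
  "L1_mat a m = mat1 m (\<lambda>i j. if i = j then 1 else if i = j + 1 then a (3 * j - 1) else 0)"

definition L2_mat :: "(nat \<Rightarrow> real) \<Rightarrow> nat \<Rightarrow> real mat" where
  "L2_mat a m = mat1 m (\<lambda>i j. if i = j then 1 else if i = j + 1 then a (3 * j) else 0)"

definition U_mat :: "(nat \<Rightarrow> real) \<Rightarrow> nat \<Rightarrow> real mat" where
  "U_mat a m = mat1 m (\<lambda>i j. if i = j then a (3 * i - 2) else if j = i + 1 then 1 else 0)"

(* The terminating series 2F1(-p, x; u; z). The sum stops at j = p by definition, so no
   term with j > p contributes even if u is a nonpositive integer. *)
definition hyp2F1 :: "nat \<Rightarrow> real \<Rightarrow> real \<Rightarrow> real \<Rightarrow> real" where
  "hyp2F1 p x u z =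
     (\<Sum>j\<le>p. pochhammer (- real p) j * pochhammer x j / (pochhammer u j * fact j) * z ^ j)"

(* Recurrence coefficients of the multiple Kravchuk polynomials; k = n div 2, so that the two
   branches are the formulas for n = 2k and n = 2k+1. *)
definition kravchuk_b :: "nat \<Rightarrow> real \<Rightarrow> real \<Rightarrow> nat \<Rightarrow> real" where
  "kravchuk_b N p1 p2 n = (let k = real (n div 2) in
     if even n then 2 * k + (real N - 3 * k) * p1 - k * p2
     else 2 * k + 1 - (k + 1) * p1 + (real N - 3 * k - 1) * p2)"

definition kravchuk_c :: "nat \<Rightarrow> real \<Rightarrow> real \<Rightarrow> nat \<Rightarrow> real" where
  "kravchuk_c N p1 p2 n = (let k = real (n div 2) in
     if even n then (real N - 2 * k + 1) * k * (p1 * (1 - p1) + p2 * (1 - p2))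
     else (real N - 2 * k) * ((k + 1) * p1 * (1 - p1) + k * p2 * (1 - p2)))"

definition kravchuk_d :: "nat \<Rightarrow> real \<Rightarrow> real \<Rightarrow> nat \<Rightarrow> real" where
  "kravchuk_d N p1 p2 n = (let k = real (n div 2) in
     if even n then (real N - 2 * k + 1) * (real N - 2 * k + 2) * k * p1 * (1 - p1) * (p1 - p2)
     else (real N - 2 * k) * (real N - 2 * k + 1) * k * p2 * (1 - p2) * (p2 - p1))"

end

theory Submission
  imports Defs
begin

text \<open>
  With \<open>w = - z\<close>, the series \<open>2F1(-p, -N; -(p+s); z)\<close> times \<open>(p+s) choose s\<close> is the
  coefficient \<open>G(p, s)\<close> of \<open>t^p\<close> in \<open>(1 - t)^(-s-1) * (1 + w t)^N\<close>. These numbers satisfy a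
  Pascal rule and one four-term recurrence, and these give linear relations among
  \<open>A n = 2F1(-n, -N; -2n; z)\<close> and \<open>B n = 2F1(-n-1, -N; -2n-1; z)\<close>. All series in the \<open>a\<close>'s are of
  the form \<open>A n\<close> or \<open>B n\<close> (except the one in \<open>a 2\<close>, which is \<open>1\<close>): the relations evaluate
  the sums \<open>a (3i-1) + a (3i)\<close> in closed form, while in the products \<open>a (3i) * a (3i+2)\<close> the
  series cancel. The entries of the matrix product involve the series only through these sums
  and products.
\<close>

section \<open>Terminating series as generating function coefficients\<close>

definition kravchuk_sum :: "nat \<Rightarrow> real \<Rightarrow> nat \<Rightarrow> nat \<Rightarrow> real" where
  "kravchuk_sum N w p s =
     (\<Sum>j\<le>p. real ((p + s - j) choose s) * real (N choose j) * w ^ j)"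

lemma pochhammer_minus_of_nat:
  "pochhammer (- real n) j = (-1) ^ j * fact j * real (n choose j)"
  by (simp add: binomial_gbinomial gbinomial_pochhammer)

text \<open>Each Pochhammer symbol at a negative integer is a signed binomial coefficient. For j
  \<le> p trinomial revision turns (p choose j) / (p+s choose j) into (p+s-j choose s) / (p+s choose
  s), with no vanishing denominator. The one sign (-1)^j that survives is absorbed into (-
  z)^j.\<close>

lemma hyp2F1_eq_kravchuk_sum:
  assumes "u = - real (p + s)"
  shows "hyp2F1 p (- real N) u z = kravchuk_sum N (- z) p s / real ((p + s) choose s)"
proof -
  have "pochhammer (- real p) j * pochhammer (- real N) j / (pochhammer u j * fact j) * z ^ j
      = real ((p + s - j) choose s) * real (N choose j) * (- z) ^ j / real ((p + s) choose s)"
    if j: "j \<le> p" for j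
  proof -
    have "((p + s) choose p) * (p choose j) = ((p + s) choose j) * ((p + s - j) choose (p - j))"
      using j by (intro choose_mult) auto
    moreover have "(p + s) choose p = (p + s) choose s"
      using binomial_symmetric[of p "p + s"] by simp
    moreover have "(p + s - j) choose (p - j) = (p + s - j) choose s"
      using binomial_symmetric[of "p - j" "p + s - j"] j by simp
    ultimately have "real (p choose j) * real ((p + s) choose s)
        = real ((p + s) choose j) * real ((p + s - j) choose s)"
      by (metis mult.commute of_nat_mult)
    moreover have "real ((p + s) choose j) \<noteq> 0" "real ((p + s) choose s) \<noteq> 0"
      using j by auto
    ultimately have "real (p choose j) / real ((p + s) choose j)
        = real ((p + s - j) choose s) / real ((p + s) choose s)"
      by (simp add: field_simps)
    moreover have "pochhammer (- real p) j * pochhammer (- real N) j / (pochhammer u j * fact j)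
        * z ^ j = real (p choose j) / real ((p + s) choose j) * real (N choose j) * (- z) ^ j"
      unfolding assms pochhammer_minus_of_nat power_minus[of z]
      by (simp add: minus_one_power_iff mult_ac)
    ultimately show ?thesis
      by simp
  qed
  then show ?thesis
    by (simp add: hyp2F1_def kravchuk_sum_def sum_divide_distrib)
qed

text \<open>On generating functions this is (1 - t) * (1 - t)^(-s-2) = (1 - t)^(-s-1), read off at
  t^(p+1).\<close>

lemma kravchuk_sum_Pascal:
  "kravchuk_sum N w (Suc p) (Suc s) = kravchuk_sum N w (Suc p) s + kravchuk_sum N w p (Suc s)"
proof -
  have "(Suc p + Suc s - j) choose Suc s = ((Suc p + s - j) choose s) + ((p + Suc s - j) choose Suc s)"
    if "j \<le> p" for j
    using that by (simp add: Suc_diff_le)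
  then show ?thesis
    by (simp add: kravchuk_sum_def sum.distrib[symmetric] distrib_right)
qed

text \<open>The sum \<open>?M\<close>, which is G(p+1, s) with an extra factor j in each term, is
  computed in two ways: once by absorbing j into (N choose j), once by absorbing it into (p+1+s-j
  choose s). Equating the two results gives the relation.\<close>

lemma kravchuk_sum_recurrence:
  "(real N - real p - real s - 1) * w * kravchuk_sum N w p s
   = (real p + real s + 2) * kravchuk_sum N w (Suc p) s
     - (real s + 1) * kravchuk_sum N w (Suc p) (Suc s)
     - (real s + 1) * w * kravchuk_sum N w p (Suc s)"
proof -
  let ?M = "\<Sum>j\<le>Suc p. real j * real ((Suc p + s - j) choose s) * real (N choose j) * w ^ j"
  have absorb: "(real s + 1) * real ((q + Suc s - j) choose Suc s)
      = (real q + real s + 1 - real j) * real ((q + s - j) choose s)" if "j \<le> q" for q j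
  proof -
    have "Suc s * ((q + Suc s - j) choose Suc s) = (Suc (q + s) - j) * ((q + s - j) choose s)"
      using Suc_times_binomial[of s "q + s - j"] that by (simp add: Suc_diff_le)
    then have "real (Suc s) * real ((q + Suc s - j) choose Suc s)
        = real (Suc (q + s) - j) * real ((q + s - j) choose s)"
      by (metis of_nat_mult)
    then show ?thesis
      using that by (simp add: of_nat_diff algebra_simps)
  qed
  have Nj: "(real N - real j) * real (N choose j) = (real j + 1) * real (N choose Suc j)" for j
  proof (cases "j \<le> N")
    case True
    have "Suc j * (N choose Suc j) = (N - j) * (N choose j)"
      using binomial_absorb_comp binomial_absorption
      by (metis mult.commute)
    then have "real (Suc j) * real (N choose Suc j) = real (N - j) * real (N choose j)"
      by (metis of_nat_mult)
    with True show ?thesis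
      by (simp add: of_nat_diff algebra_simps)
  qed (simp add: binomial_eq_0)
  \<comment> \<open>The term at j = 0 vanishes, so the index shift lowers the upper limit to
    \<open>p\<close>.\<close>
  have "?M = (\<Sum>j\<le>p. real (Suc j) * real ((p + s - j) choose s) * real (N choose Suc j) * w ^ Suc j)"
    by (subst sum.atMost_Suc_shift) simp
  also have "\<dots> = (\<Sum>j\<le>p. (real N - real j) * real ((p + s - j) choose s)
      * real (N choose j) * w ^ Suc j)"
  proof (rule sum.cong)
    fix j
    show "real (Suc j) * real ((p + s - j) choose s) * real (N choose Suc j) * w ^ Suc j
        = (real N - real j) * real ((p + s - j) choose s) * real (N choose j) * w ^ Suc j"
      using arg_cong[OF Nj[of j], of "\<lambda>x. x * real ((p + s - j) choose s) * w ^ Suc j"]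
      by (simp add: algebra_simps)
  qed simp
  \<comment> \<open>Split N - j = (N - p - s - 1) + (p + s + 1 - j); the second summand is absorbed
    and raises s to s + 1.\<close>
  also have "\<dots> = (\<Sum>j\<le>p. (real N - real p - real s - 1) * w
          * (real ((p + s - j) choose s) * real (N choose j) * w ^ j)
        + w * ((real s + 1) * real ((p + Suc s - j) choose Suc s)) * real (N choose j) * w ^ j)"
  proof (rule sum.cong)
    fix j
    assume "j \<in> {..p}"
    then have j: "j \<le> p" by simp
    show "(real N - real j) * real ((p + s - j) choose s) * real (N choose j) * w ^ Suc j
      = (real N - real p - real s - 1) * w * (real ((p + s - j) choose s) * real (N choose j) * w ^ j)
        + w * ((real s + 1) * real ((p + Suc s - j) choose Suc s)) * real (N choose j) * w ^ j"
      unfolding absorb[OF j] by (simp add: algebra_simps)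
  qed simp
  also have "\<dots> = (real N - real p - real s - 1) * w * kravchuk_sum N w p s
      + (real s + 1) * w * kravchuk_sum N w p (Suc s)"
    by (simp add: kravchuk_sum_def sum.distrib sum_distrib_left mult_ac)
  finally have M: "?M = \<dots>" .
  have "(real s + 1) * kravchuk_sum N w (Suc p) (Suc s)
      = (\<Sum>j\<le>Suc p. ((real s + 1) * real ((Suc p + Suc s - j) choose Suc s))
          * real (N choose j) * w ^ j)"
    unfolding kravchuk_sum_def sum_distrib_left by (simp only: mult_ac)
  also have "\<dots> = (\<Sum>j\<le>Suc p. (real p + real s + 2)
          * (real ((Suc p + s - j) choose s) * real (N choose j) * w ^ j)
        - real j * real ((Suc p + s - j) choose s) * real (N choose j) * w ^ j)"
  proof (rule sum.cong)
    fix j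
    assume "j \<in> {..Suc p}"
    then have j: "j \<le> Suc p" by simp
    show "(real s + 1) * real ((Suc p + Suc s - j) choose Suc s) * real (N choose j) * w ^ j
      = (real p + real s + 2) * (real ((Suc p + s - j) choose s) * real (N choose j) * w ^ j)
        - real j * real ((Suc p + s - j) choose s) * real (N choose j) * w ^ j"
      unfolding absorb[OF j] by (simp add: algebra_simps)
  qed simp
  also have "\<dots> = (real p + real s + 2) * kravchuk_sum N w (Suc p) s - ?M"
    unfolding kravchuk_sum_def sum_distrib_left sum_subtractf ..
  finally show ?thesis
    using M by simp
qed

section \<open>Contiguous relations for the central series\<close>

lemma central_binomial_odd:
  "real ((2 * n + 1) choose n) * (real n + 1) = (2 * real n + 1) * real ((2 * n) choose n)"
proof -
  have "Suc n * (Suc (2 * n) choose Suc n) = Suc (2 * n) * ((2 * n) choose n)"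
    by (rule Suc_times_binomial)
  moreover have "Suc (2 * n) choose Suc n = (2 * n + 1) choose n"
    using binomial_symmetric[of n "2 * n + 1"] by simp
  ultimately have "real (Suc n) * real ((2 * n + 1) choose n)
      = real (Suc (2 * n)) * real ((2 * n) choose n)"
    by (metis of_nat_mult)
  then show ?thesis by (simp add: algebra_simps)
qed

lemma central_binomial_even:
  "real ((2 * n + 2) choose (n + 1)) = 2 * real ((2 * n + 1) choose n)"
proof -
  have "(2 * n + 1) choose (n + 1) = (2 * n + 1) choose n"
    using binomial_symmetric[of n "2 * n + 1"] by simp
  then show ?thesis by simp
qed

text \<open>Relates A (n+1), B n and A n. At p = s = n the Pascal rule eliminates G(n, n+1) from the
  four-term recurrence; the central binomial identities then express all normalising constants by
  (2n choose n).\<close>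

lemma hyp2F1_contiguous_odd:
  "2 * (2 * real n + 1) * (1 - z) * hyp2F1 (n + 1) (- real N) (- 2 * real n - 2) z
   = (2 * real n + 1) * (2 - z) * hyp2F1 (n + 1) (- real N) (- 2 * real n - 1) z
     + (real N - 2 * real n - 1) * z * hyp2F1 n (- real N) (- 2 * real n) z"
proof -
  let ?G = "kravchuk_sum N (- z)"
  let ?q = "real ((2 * n) choose n)" and ?r = "real ((2 * n + 1) choose n)"
  have F: "hyp2F1 (n + 1) (- real N) (- 2 * real n - 2) z = ?G (n + 1) (n + 1) / (2 * ?r)"
    "hyp2F1 (n + 1) (- real N) (- 2 * real n - 1) z = ?G (n + 1) n / ?r"
    "hyp2F1 n (- real N) (- 2 * real n) z = ?G n n / ?q"
    using hyp2F1_eq_kravchuk_sum[of "- 2 * real n - 2" "n + 1" "n + 1" N z]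
      hyp2F1_eq_kravchuk_sum[of "- 2 * real n - 1" "n + 1" n N z]
      hyp2F1_eq_kravchuk_sum[of "- 2 * real n" n n N z] central_binomial_even[of n]
    by (simp_all add: mult_2[symmetric])
  have pos: "?q \<noteq> 0" by auto
  have r: "?r = (2 * real n + 1) * ?q / (real n + 1)"
    using central_binomial_odd[of n] by (simp add: field_simps)
  have "(real n + 1) * ((1 - z) * ?G (n + 1) (n + 1))
      = (real n + 1) * ((2 - z) * ?G (n + 1) n) + (real N - 2 * real n - 1) * z * ?G n n"
    using kravchuk_sum_recurrence[of N n n "- z"] kravchuk_sum_Pascal[of N "- z" n n]
    by (simp add: algebra_simps)
  with pos show ?thesis
    unfolding F r by (simp add: divide_simps) (simp add: algebra_simps)
qed

text \<open>Relates B (n+1), A (n+1) and B n. This time p = n + 1 and s = n, and the Pascal rule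
  eliminates G(n+2, n).\<close>

lemma hyp2F1_contiguous_even:
  "(2 * real n + 3) * hyp2F1 (n + 2) (- real N) (- 2 * real n - 3) z
   = (2 * real n + 3 - (real n + 1) * z) * hyp2F1 (n + 1) (- real N) (- 2 * real n - 2) z
     - (real N - 2 * real n - 2) * z * hyp2F1 (n + 1) (- real N) (- 2 * real n - 1) z / 2"
proof -
  let ?G = "kravchuk_sum N (- z)"
  let ?q = "real ((2 * n + 1) choose n)" and ?r = "real ((2 * n + 3) choose (n + 1))"
  have F: "hyp2F1 (n + 1) (- real N) (- 2 * real n - 2) z = ?G (n + 1) (n + 1) / (2 * ?q)"
    "hyp2F1 (n + 1) (- real N) (- 2 * real n - 1) z = ?G (n + 1) n / ?q"
    "hyp2F1 (n + 2) (- real N) (- 2 * real n - 3) z = ?G (n + 2) (n + 1) / ?r"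
    using hyp2F1_eq_kravchuk_sum[of "- 2 * real n - 2" "n + 1" "n + 1" N z]
      hyp2F1_eq_kravchuk_sum[of "- 2 * real n - 1" "n + 1" n N z]
      hyp2F1_eq_kravchuk_sum[of "- 2 * real n - 3" "n + 2" "n + 1" N z] central_binomial_even[of n]
    by (simp_all add: mult_2[symmetric] numeral_3_eq_3)
  have pos: "?q \<noteq> 0" by auto
  have r: "?r = (2 * real n + 3) * (2 * ?q) / (real n + 2)"
  proof -
    have e: "2 * (n + 1) = 2 * n + 2" "2 * n + 2 + 1 = 2 * n + 3" "real (n + 1) + 1 = real n + 2"
      "2 * real (n + 1) + 1 = 2 * real n + 3"
      by simp_all
    show ?thesis
      using central_binomial_odd[of "n + 1"] unfolding e central_binomial_even
      by (simp only: nonzero_eq_divide_eq)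
  qed
  have "(real n + 2) * ?G (n + 2) (n + 1)
      = (2 * real n + 3 - (real n + 1) * z) * ?G (n + 1) (n + 1)
        - (real N - 2 * real n - 2) * z * ?G (n + 1) n"
    using kravchuk_sum_recurrence[of N "n + 1" n "- z"] kravchuk_sum_Pascal[of N "- z" "n + 1" n]
    by (simp add: algebra_simps numeral_2_eq_2)
  with pos show ?thesis
    unfolding F r by (simp add: divide_simps) (simp add: algebra_simps)
qed

section \<open>Entries of the bidiagonal product\<close>

lemma index_bidiagonal_mult:
  assumes "i < m" "j < n" "X \<in> carrier_mat m n"
  shows "(mat1 m (\<lambda>i j. if i = j then 1 else if i = j + 1 then l j else 0) * X) $$ (i, j)
    = X $$ (i, j) + (if i = 0 then 0 else l i * X $$ (i - 1, j))"
proof -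
  have "(mat1 m (\<lambda>i j. if i = j then 1 else if i = j + 1 then l j else 0) * X) $$ (i, j)
      = (\<Sum>k<m. (if i = k then 1 else if i = k + 1 then l (k + 1) else 0) * X $$ (k, j))"
    using assms by (auto simp: mat1_def scalar_prod_def atLeast0LessThan intro!: sum.cong)
  \<comment> \<open>Left multiplication adds to row i the multiple \<open>l i\<close> of the row
    above: the 1-based column of that subdiagonal entry is the 0-based row i. For i = 0 truncated
    subtraction makes k = 0 match, and the inner test removes this spurious term.\<close>
  also have "\<dots> = (\<Sum>k<m. (if k = i then X $$ (i, j) else 0)
      + (if k = i - 1 then (if i = 0 then 0 else l i * X $$ (i - 1, j)) else 0))"
    by (rule sum.cong) auto
  also have "\<dots> = X $$ (i, j) + (if i = 0 then 0 else l i * X $$ (i - 1, j))"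
    using assms by (simp add: sum.distrib)
  finally show ?thesis .
qed

text \<open>Multiplying out the three factors gives one scalar equation per entry on the diagonal
  and the two subdiagonals. The entries \<open>b 0\<close> and \<open>c 1\<close> stand apart
  because their rows have too few rows above them, so the terms that would need \<open>a\<close> at
  index 0 or below are absent.\<close>

lemma tetradiag_eq_bidiagonal_product:
  assumes b0: "b 0 = a 1"
    and b: "\<And>i. b (i + 1) = a (3 * i + 4) + a (3 * i + 3) + a (3 * i + 2)"
    and c1: "c 1 = (a 2 + a 3) * a 1"
    and c: "\<And>i. c (i + 2) = (a (3 * i + 5) + a (3 * i + 6)) * a (3 * i + 4) + a (3 * i + 5) * a (3 * i + 3)"
    and d: "\<And>i. d (i + 2) = a (3 * i + 5) * a (3 * i + 3) * a (3 * i + 1)"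
  shows "tetradiag b c d m = L1_mat a m * L2_mat a m * U_mat a m"
proof -
  have carrier: "L1_mat a m \<in> carrier_mat m m" "L2_mat a m \<in> carrier_mat m m"
    "U_mat a m \<in> carrier_mat m m"
    by (auto simp: L1_mat_def L2_mat_def U_mat_def mat1_def)
  then have carrier2: "L2_mat a m * U_mat a m \<in> carrier_mat m m"
    by simp
  have "tetradiag b c d m = L1_mat a m * (L2_mat a m * U_mat a m)"
  proof (rule eq_matI)
    fix i j
    assume "i < dim_row (L1_mat a m * (L2_mat a m * U_mat a m))"
      "j < dim_col (L1_mat a m * (L2_mat a m * U_mat a m))"
    with carrier have ij: "i < m" "j < m" by auto
    have L1: "(L1_mat a m * (L2_mat a m * U_mat a m)) $$ (i, j)
        = (L2_mat a m * U_mat a m) $$ (i, j)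
          + (if i = 0 then 0 else a (3 * i - 1) * (L2_mat a m * U_mat a m) $$ (i - 1, j))"
      unfolding L1_mat_def by (rule index_bidiagonal_mult[OF ij carrier2])
    have L2: "(L2_mat a m * U_mat a m) $$ (k, j)
        = U_mat a m $$ (k, j) + (if k = 0 then 0 else a (3 * k) * U_mat a m $$ (k - 1, j))"
      if "k < m" for k
      unfolding L2_mat_def by (rule index_bidiagonal_mult[OF that ij(2) carrier(3)])
    have U: "U_mat a m $$ (k, j) = (if k = j then a (3 * k + 1) else if j = k + 1 then 1 else 0)"
      if "k < m" for k
      using that ij by (simp add: U_mat_def mat1_def)
    \<comment> \<open>With 0-based rows all three sequences carry the row index: the 1-based column
      j + 1 gives c (j+1) = c i on the first subdiagonal and d (j+2) = d i on the second.\<close>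
    have T: "tetradiag b c d m $$ (i, j) = (if i = j then b i else if j = i + 1 then 1
        else if i = j + 1 then c i else if i = j + 2 then d i else 0)"
      using ij by (auto simp: tetradiag_def mat1_def)
    \<comment> \<open>Row i of the product combines rows i, i - 1 and i - 2 of
      \<open>U_mat a m\<close>. From i = k + 2 on all three exist, and only columns k to k + 3 can
      be nonzero.\<close>
    consider "i = 0" | "i = 1" | k where "i = k + 2"
      by (metis One_nat_def add_2_eq_Suc' not0_implies_Suc)
    then show "tetradiag b c d m $$ (i, j) = (L1_mat a m * (L2_mat a m * U_mat a m)) $$ (i, j)"
    proof cases
      case 1
      with ij show ?thesis unfolding T L1 by (simp add: L2 U b0)
    next
      case 2
      with ij show ?thesis
        unfolding T L1 using b[of 0] c1
        by (auto simp: L2 U b0 numeral_eq_Suc algebra_simps)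
    next
      case (3 k)
      have e: "3 * (k + 2) - 1 = 3 * k + 5" "3 * (k + 2) = 3 * k + 6" "3 * (k + 2) + 1 = 3 * k + 7"
        "3 * (k + 1) = 3 * k + 3" "3 * (k + 1) + 1 = 3 * k + 4" "k + 2 - 1 = k + 1"
        "k + 1 - 1 = k" "k + 2 \<noteq> 0" "k + 1 \<noteq> 0"
        by simp_all
      have k: "k < m" "k + 1 < m" "k + 2 < m" using ij 3 by auto
      consider "j = k" | "j = k + 1" | "j = k + 2" | "j = k + 3" | "j < k \<or> j > k + 3"
        by linarith
      then show ?thesis
        unfolding T L1 unfolding 3 e L2[OF k(3)] L2[OF k(2)] U[OF k(1)] U[OF k(2)] U[OF k(3)]
        using b[of "k + 1"] c[of k] d[of k]
        by cases (auto simp: e L2 U k algebra_simps)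
    qed
  qed (use carrier in \<open>auto simp: tetradiag_def mat1_def\<close>)
  then show ?thesis
    using carrier assoc_mult_mat by metis
qed

section \<open>Application to the Kravchuk coefficients\<close>

lemma pochhammer_ratio:
  assumes n: "n > 0"
  shows "pochhammer (real n) n / pochhammer (real n + 1) n = 1 / 2"
proof -
  \<comment> \<open>Both sides are (n)_{n+1}, with the first or the last factor split off. At n = 0
    the quotient would be 1 instead of 1/2, so \<open>a 2\<close> is treated separately in the
    theorem.\<close>
  have "real n * pochhammer (real n + 1) n = pochhammer (real n) n * (2 * real n)"
    using pochhammer_rec[of "real n" n] pochhammer_rec'[of "real n" n]
    by (simp only: mult_2[symmetric] mult_ac)
  moreover have "pochhammer (real n + 1) n > 0"
    by (rule pochhammer_pos) simp
  ultimately show ?thesis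
    using n by (simp add: field_simps)
qed

theorem proposition3p5:
  fixes N m :: nat and p1 p2 z :: real and a :: "nat \<Rightarrow> real"
  assumes N: "N \<ge> 1"
    and p1: "p1 \<noteq> 1"
    and z: "z = (p2 - p1) / (1 - p1)"
    and denom1: "\<And>n::nat. hyp2F1 n (- real N) (- 2 * real n) z \<noteq> 0"
    and denom2: "\<And>n::nat. hyp2F1 (n + 1) (- real N) (- 2 * real n - 1) z \<noteq> 0"
    and a1: "\<And>n::nat. a (6 * n + 1) = (real N - 2 * real n) * p1"
    and a4: "\<And>n::nat. a (6 * n + 4) = (real N - 2 * real n - 1) * p2"
    and a2: "\<And>n::nat. a (6 * n + 2) =
          pochhammer (real n) n * (real N - 2 * real n) * (p2 - p1) / pochhammer (real n + 1) n
          * (hyp2F1 n (- real N) (- 2 * real n + 1) z / hyp2F1 n (- real N) (- 2 * real n) z)"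
    and a5: "\<And>n::nat. a (6 * n + 5) =
          (real n + 1) * (real N - 2 * real n - 1) * (p1 - p2) / (2 * real n + 1)
          * (hyp2F1 n (- real N) (- 2 * real n) z / hyp2F1 (n + 1) (- real N) (- 2 * real n - 1) z)"
    and a3: "\<And>n::nat. a (6 * n + 3) =
          (2 * real n + 1) * (1 - p1)
          * (hyp2F1 (n + 1) (- real N) (- 2 * real n - 1) z / hyp2F1 n (- real N) (- 2 * real n) z)"
    and a6: "\<And>n::nat. a (6 * n + 6) =
          2 * (real n + 1) * (1 - p2)
          * (hyp2F1 (n + 1) (- real N) (- 2 * real n - 2) z
             / hyp2F1 (n + 1) (- real N) (- 2 * real n - 1) z)"
    and m: "m \<in> {1..N + 1}"
  shows "tetradiag (kravchuk_b N p1 p2) (kravchuk_c N p1 p2) (kravchuk_d N p1 p2) m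
       = L1_mat a m * L2_mat a m * U_mat a m"
proof (rule tetradiag_eq_bidiagonal_product)
  define A where "A n = hyp2F1 n (- real N) (- 2 * real n) z" for n
  define B where "B n = hyp2F1 (n + 1) (- real N) (- 2 * real n - 1) z" for n
  have A0: "A n \<noteq> 0" and B0: "B n \<noteq> 0" for n
    using denom1 denom2 by (auto simp: A_def B_def)
  have C: "hyp2F1 (n + 1) (- real N) (- 2 * real n - 2) z = A (n + 1)" for n
  proof -
    have "- 2 * real (n + 1) = - 2 * real n - 2" by simp
    then show ?thesis unfolding A_def by metis
  qed
  \<comment> \<open>Multiplying the contiguous relations by 1 - p1 makes them polynomial in p1 and
    p2 through this identity.\<close>
  have zq: "z * (1 - p1) = p2 - p1"
    using p1 z by simp
  \<comment> \<open>The formula for a (6n+2) at n + 1: its numerator series has lower parameter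
    -2(n+1) + 1 = -2n - 1, hence equals B n.\<close>
  have a2_Suc: "a (6 * n + 8) = (real N - 2 * real n - 2) * (p2 - p1) / 2 * (B n / A (n + 1))" for n
  proof -
    have "a (6 * n + 8) = a (6 * (n + 1) + 2)"
      by (rule arg_cong[of _ _ a]) simp
    also have "\<dots> = pochhammer (real (n + 1)) (n + 1) / pochhammer (real (n + 1) + 1) (n + 1)
        * (real N - 2 * real (n + 1)) * (p2 - p1)
        * (hyp2F1 (n + 1) (- real N) (- 2 * real (n + 1) + 1) z / A (n + 1))"
      unfolding a2 A_def by simp
    also have "hyp2F1 (n + 1) (- real N) (- 2 * real (n + 1) + 1) z = B n"
    proof -
      have "- 2 * real (n + 1) + 1 = - 2 * real n - 1" by simp
      then show ?thesis unfolding B_def by metis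
    qed
    finally have eq: "a (6 * n + 8)
        = pochhammer (real (n + 1)) (n + 1) / pochhammer (real (n + 1) + 1) (n + 1)
          * (real N - 2 * real (n + 1)) * (p2 - p1) * (B n / A (n + 1))" .
    have "real N - 2 * real (n + 1) = real N - 2 * real n - 2" by simp
    then show ?thesis
      unfolding eq using pochhammer_ratio[of "n + 1"] by simp
  qed
  have a3': "a (6 * n + 3) = (2 * real n + 1) * (1 - p1) * (B n / A n)" for n
    unfolding a3 A_def B_def ..
  have a5': "a (6 * n + 5) = (real n + 1) * (real N - 2 * real n - 1) * (p1 - p2) / (2 * real n + 1)
      * (A n / B n)" for n
    unfolding a5 A_def B_def ..
  have a6': "a (6 * n + 6) = 2 * (real n + 1) * (1 - p2) * (A (n + 1) / B n)" for n
    unfolding a6 C B_def ..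
  have a2_0: "a 2 = real N * (p2 - p1)"
    using a2[of 0] by (simp add: hyp2F1_def numeral_2_eq_2)
  have a3_9: "a (6 * n + 9) = (2 * real n + 3) * (1 - p1) * (B (n + 1) / A (n + 1))" for n
    using a3'[of "n + 1"] by (simp add: algebra_simps)

  \<comment> \<open>The odd relation times 1 - p1, divided by (2n+1) * B n: its A n / B n term is
    cancelled by a (6n+5).\<close>
  have sum56: "a (6 * n + 5) + a (6 * n + 6) = (real n + 1) * (2 - p1 - p2)" for n
  proof -
    have "2 * (2 * real n + 1) * (1 - z) * A (n + 1)
        = (2 * real n + 1) * (2 - z) * B n + (real N - 2 * real n - 1) * z * A n"
      using hyp2F1_contiguous_odd[of n z N] unfolding C A_def[symmetric] B_def[symmetric] .
    then have "(1 - p1) * (2 * (2 * real n + 1) * (1 - z) * A (n + 1))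
        = (1 - p1) * ((2 * real n + 1) * (2 - z) * B n + (real N - 2 * real n - 1) * z * A n)"
      by simp
    moreover have "(1 - p1) * (2 * (2 * real n + 1) * (1 - z) * A (n + 1))
        = 2 * (2 * real n + 1) * A (n + 1) * ((1 - p1) - z * (1 - p1))"
      by (simp add: algebra_simps)
    moreover have "(1 - p1) * ((2 * real n + 1) * (2 - z) * B n + (real N - 2 * real n - 1) * z * A n)
        = (2 * real n + 1) * B n * (2 * (1 - p1) - z * (1 - p1))
          + (real N - 2 * real n - 1) * A n * (z * (1 - p1))"
      by (simp add: algebra_simps)
    ultimately have "2 * (1 - p2) * (2 * real n + 1) * A (n + 1)
        = (2 * real n + 1) * (2 - p1 - p2) * B n + (real N - 2 * real n - 1) * (p2 - p1) * A n"
      unfolding zq by (simp add: algebra_simps)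
    \<comment> \<open>Solves a linear relation for x / y; used with x = A (n+1), y = B n, w = A n
      and d = 2n + 1.\<close>
    moreover have "\<alpha> * (x / y) = \<beta> + \<gamma> / d * (w / y)"
      if "\<alpha> * d * x = d * \<beta> * y + \<gamma> * w" "d \<noteq> 0" "y \<noteq> 0" for \<alpha> \<beta> \<gamma> d w x y :: real
      using that by (simp add: field_simps)
    ultimately have "2 * (1 - p2) * (A (n + 1) / B n) = (2 - p1 - p2)
        + (real N - 2 * real n - 1) * (p2 - p1) / (2 * real n + 1) * (A n / B n)"
      using B0[of n] by simp
    also have "\<dots> = (2 - p1 - p2)
        - (real N - 2 * real n - 1) * (p1 - p2) / (2 * real n + 1) * (A n / B n)"
      by (simp add: diff_divide_distrib algebra_simps)
    finally have "2 * (1 - p2) * (A (n + 1) / B n) = \<dots>" .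
    moreover have "a (6 * n + 5) + a (6 * n + 6) = (real n + 1) *
        ((real N - 2 * real n - 1) * (p1 - p2) / (2 * real n + 1) * (A n / B n)
          + 2 * (1 - p2) * (A (n + 1) / B n))"
      unfolding a5' a6' by (simp add: algebra_simps add_divide_distrib diff_divide_distrib)
    ultimately show ?thesis by simp
  qed
  \<comment> \<open>The even relation times 1 - p1, divided by A (n+1): its B n / A (n+1) term is
    cancelled by a (6n+8).\<close>
  have sum89: "a (6 * n + 8) + a (6 * n + 9) = (real n + 2) * (1 - p1) + (real n + 1) * (1 - p2)" for n
  proof -
    have B: "hyp2F1 (n + 2) (- real N) (- 2 * real n - 3) z = B (n + 1)"
    proof -
      have "- 2 * real (n + 1) - 1 = - 2 * real n - 3" "n + 1 + 1 = n + 2" by simp_all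
      then show ?thesis unfolding B_def by metis
    qed
    have "(2 * real n + 3) * B (n + 1) = (2 * real n + 3 - (real n + 1) * z) * A (n + 1)
        - (real N - 2 * real n - 2) * z * B n / 2"
      using hyp2F1_contiguous_even[of n N z] unfolding B C B_def[symmetric] .
    moreover have "\<alpha> * (x / y) = \<beta> - \<gamma> / 2 * (w / y)"
      if "\<alpha> * x = \<beta> * y - \<gamma> * w / 2" "y \<noteq> 0" for \<alpha> \<beta> \<gamma> w x y :: real
      using that by (simp add: field_simps)
    ultimately have "(2 * real n + 3) * (B (n + 1) / A (n + 1)) = (2 * real n + 3 - (real n + 1) * z)
        - (real N - 2 * real n - 2) * z / 2 * (B n / A (n + 1))"
      using A0[of "n + 1"] by blast
    moreover have "a (6 * n + 8) + a (6 * n + 9)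
        = (real N - 2 * real n - 2) * (z * (1 - p1)) / 2 * (B n / A (n + 1))
          + (1 - p1) * ((2 * real n + 3) * (B (n + 1) / A (n + 1)))"
      unfolding a2_Suc a3_9 zq by simp
    moreover have "\<kappa> * (z * (1 - p1)) / 2 * w + (1 - p1) * (\<mu> - \<kappa> * z / 2 * w) = (1 - p1) * \<mu>"
      for \<kappa> \<mu> w :: real
      by (simp add: field_simps)
    ultimately have "a (6 * n + 8) + a (6 * n + 9)
        = (1 - p1) * (2 * real n + 3 - (real n + 1) * z)"
      by (simp only:)
    also have "\<dots> = (1 - p1) * (2 * real n + 3) - (real n + 1) * (z * (1 - p1))"
      by (simp add: algebra_simps)
    finally have "a (6 * n + 8) + a (6 * n + 9) = \<dots>" .
    then show ?thesis
      unfolding zq by (simp add: algebra_simps)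
  qed
  \<comment> \<open>Formally the case n = -1 of \<open>sum89\<close>, checked directly from the
    first two series.\<close>
  have sum23: "a 2 + a 3 = 1 - p1"
  proof -
    have "A 0 = 1" by (simp add: A_def hyp2F1_def)
    moreover have "B 0 = 1 - real N * z" by (simp add: B_def hyp2F1_def)
    ultimately have "a 3 = (1 - p1) * (1 - real N * z)" using a3'[of 0] by simp
    then have "a 3 = (1 - p1) - real N * (z * (1 - p1))" by (simp add: algebra_simps)
    with a2_0 show ?thesis unfolding zq by simp
  qed
  \<comment> \<open>The two factors carry the reciprocal quotients A n / B n and B n / A n; in
    \<open>prod68\<close> they are B n / A (n+1) and its inverse.\<close>
  have prod35: "a (6 * n + 5) * a (6 * n + 3)
      = (real n + 1) * (real N - 2 * real n - 1) * (p1 - p2) * (1 - p1)" for n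
    unfolding a3' a5' using A0[of n] B0[of n] by simp
  have prod68: "a (6 * n + 8) * a (6 * n + 6)
      = (real n + 1) * (real N - 2 * real n - 2) * (p2 - p1) * (1 - p2)" for n
    unfolding a2_Suc a6' using A0[of "n + 1"] B0[of n] by simp (simp add: algebra_simps)
  have a7: "a (6 * n + 7) = (real N - 2 * real n - 2) * p1" for n
    using a1[of "n + 1"] by (simp add: algebra_simps)

  show "kravchuk_b N p1 p2 0 = a 1"
    using a1[of 0] by (simp add: kravchuk_b_def)
  show "kravchuk_c N p1 p2 1 = (a 2 + a 3) * a 1"
    using a1[of 0] unfolding sum23 by (simp add: kravchuk_c_def)
  \<comment> \<open>Writing i = 2n or i = 2n + 1 turns 3i + r into 6n + r or 6n + 3 + r. The parity
    of i thus decides which sum and which product occur: for even i, \<open>b\<close> uses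
    \<open>sum23\<close> or \<open>sum89\<close>, \<open>c\<close> uses \<open>sum56\<close> and
    \<open>prod35\<close>, \<open>d\<close> uses \<open>prod35\<close>; for odd i, \<open>b\<close>
    uses \<open>sum56\<close>, \<open>c\<close> uses \<open>sum89\<close> and \<open>prod68\<close>,
    \<open>d\<close> uses \<open>prod68\<close>.\<close>
  fix i
  show "kravchuk_b N p1 p2 (i + 1) = a (3 * i + 4) + a (3 * i + 3) + a (3 * i + 2)"
  proof (cases "even i")
    case True
    then obtain n where i: "i = 2 * n" by (elim evenE)
    have "a (6 * n + 3) + a (6 * n + 2) = (real n + 1) * (1 - p1) + real n * (1 - p2)"
    proof (cases n)
      case 0
      with sum23 show ?thesis by (simp add: numeral_2_eq_2 add.commute)
    next
      case (Suc k)
      then show ?thesis using sum89[of k] by (simp add: algebra_simps)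
    qed
    then show ?thesis
      using a4[of n] by (simp add: i kravchuk_b_def Let_def algebra_simps)
  next
    case False
    then obtain n where i: "i = 2 * n + 1" by (elim oddE)
    then show ?thesis
      using sum56[of n] a7[of n] by (simp add: kravchuk_b_def Let_def algebra_simps)
  qed
  show "kravchuk_c N p1 p2 (i + 2)
      = (a (3 * i + 5) + a (3 * i + 6)) * a (3 * i + 4) + a (3 * i + 5) * a (3 * i + 3)"
  proof (cases "even i")
    case True
    then obtain n where i: "i = 2 * n" by (elim evenE)
    have "(a (3 * i + 5) + a (3 * i + 6)) * a (3 * i + 4) + a (3 * i + 5) * a (3 * i + 3)
      = (real n + 1) * (2 - p1 - p2) * ((real N - 2 * real n - 1) * p2)
        + (real n + 1) * (real N - 2 * real n - 1) * (p1 - p2) * (1 - p1)"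
      using sum56[of n] prod35[of n] a4[of n] by (simp add: i)
    then show ?thesis
      by (simp add: i kravchuk_c_def Let_def algebra_simps)
  next
    case False
    then obtain n where i: "i = 2 * n + 1" by (elim oddE)
    have "(a (3 * i + 5) + a (3 * i + 6)) * a (3 * i + 4) + a (3 * i + 5) * a (3 * i + 3)
      = ((real n + 2) * (1 - p1) + (real n + 1) * (1 - p2)) * ((real N - 2 * real n - 2) * p1)
        + (real n + 1) * (real N - 2 * real n - 2) * (p2 - p1) * (1 - p2)"
      using sum89[of n] prod68[of n] a7[of n] by (simp add: i add.commute)
    then show ?thesis
      by (simp add: i kravchuk_c_def Let_def algebra_simps)
  qed
  show "kravchuk_d N p1 p2 (i + 2) = a (3 * i + 5) * a (3 * i + 3) * a (3 * i + 1)"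
  proof (cases "even i")
    case True
    then obtain n where i: "i = 2 * n" by (elim evenE)
    have "a (3 * i + 5) * a (3 * i + 3) * a (3 * i + 1)
      = (real n + 1) * (real N - 2 * real n - 1) * (p1 - p2) * (1 - p1) * ((real N - 2 * real n) * p1)"
      using prod35[of n] a1[of n] by (simp add: i)
    then show ?thesis
      by (simp add: i kravchuk_d_def Let_def algebra_simps)
  next
    case False
    then obtain n where i: "i = 2 * n + 1" by (elim oddE)
    have "a (3 * i + 5) * a (3 * i + 3) * a (3 * i + 1)
      = (real n + 1) * (real N - 2 * real n - 2) * (p2 - p1) * (1 - p2)
        * ((real N - 2 * real n - 1) * p2)"
      using prod68[of n] a4[of n] by (simp add: i add.commute)
    then show ?thesis
      by (simp add: i kravchuk_d_def Let_def algebra_simps)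
  qed
qed

end
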